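(* Let $f\colon\mathbf R^d_+\to\mathbf R\cup\{+\infty\}$ be a symmetric function and let $F\colon\mathcal P_2^\circ\to\mathbf R\cup\{+\infty\}$ be the spectral function given by $F(\mu)=f(\lambda(\Sigma_\mu))$. Then for any $\rho>0$ and $\mu\in\mathcal P_2^\circ$, $$F_\rho(\mu)=f_\rho(\lambda(\Sigma_\mu)).$$
   Context: $\mathcal P_2^\circ$ is the set of centered Borel probability measures on $\mathbf R^d$ with finite second moment, $\Sigma_\mu=\mathbb E_\mu[xx^\top]$, and $\lambda(A)$ is the vector of eigenvalues of a symmetric matrix in nonincreasing order. $f$ is symmetric if it is invariant under all permutations of coordinates. For a function $g\colon\mathcal Y\to\mathbf R\cup\{+\infty\}$ on a metric space $(\mathcal Y,\mathsf d)$ and $\rho>0$, the Moreau envelope is $g_\rho(y)=\inf_{y'\in\mathcal Y}\{g(y')+\frac1{2\rho}\mathsf d^2(y,y')\}$. The envelope $F_\rho$ is taken in $\mathcal P_2^\circ$ with the Wasserstein-2 distance $W_2^2(\mu,\nu)=\min_{\pi\in\Pi(\mu,\nu)}\mathbb E_{(x,y)\sim\pi}\|x-y\|_2^2$, and $f_\rho$ is taken in $\mathbf R^d_+$ (nonnegative vectors) with the Hellinger distance $W_2(x,y)=\|\sqrt x-\sqrt y\|_2$ (componentwise square roots). *)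

theory Defs
  imports "HOL-Probability.Probability"
begin

text \<open>
  The coordinates of \<open>\<real>\<^sup>d\<close> are indexed by a type of sort \<open>{finite, linorder}\<close> with \<open>d\<close> elements.
  The order on the index type is used only to say that a vector is nonincreasing.
\<close>

definition centered_P2 :: "(real ^ 'n) measure set" where
  "centered_P2 = {\<mu>. prob_space \<mu> \<and> sets \<mu> = sets borel \<and>
     integrable \<mu> (\<lambda>x. (norm x)\<^sup>2) \<and> (LINT x|\<mu>. x) = 0}"

definition covariance :: "(real ^ 'n) measure \<Rightarrow> real ^ 'n ^ 'n" where
  "covariance \<mu> = (\<chi> i j. LINT x|\<mu>. x $ i * x $ j)"

text \<open>
  The eigenvalues, listed with multiplicity, are the roots of the characteristic polynomial
  \<open>t \<mapsto> det (t I - A)\<close>. For symmetric \<open>A\<close> it splits over the reals, so that exactly one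
  nonincreasing vector satisfies the description; for other matrices the value may be
  unspecified.
\<close>

definition eigenvalue_vector ::
  "real ^ ('n :: {finite, linorder}) ^ ('n :: {finite, linorder}) \<Rightarrow> real ^ ('n :: {finite, linorder})" where
  "eigenvalue_vector A = (THE v. (\<forall>i j. i \<le> j \<longrightarrow> v $ j \<le> v $ i) \<and>
     (\<forall>t. det (mat t - A) = (\<Prod>i\<in>UNIV. t - v $ i)))"

definition nonneg_vectors :: "(real ^ 'n) set" where
  "nonneg_vectors = {x. \<forall>i. 0 \<le> x $ i}"

definition symmetric_on_nonneg :: "(real ^ 'n \<Rightarrow> 'b) \<Rightarrow> bool" where
  "symmetric_on_nonneg f \<longleftrightarrow>
     (\<forall>p. p permutes UNIV \<longrightarrow> (\<forall>x\<in>nonneg_vectors. f (\<chi> i. x $ p i) = f x))"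

definition couplings ::
  "(real ^ 'n) measure \<Rightarrow> (real ^ 'n) measure \<Rightarrow> ((real ^ 'n) \<times> (real ^ 'n)) measure set" where
  "couplings \<mu> \<nu> = {\<pi>. prob_space \<pi> \<and> sets \<pi> = sets borel \<and>
     distr \<pi> borel fst = \<mu> \<and> distr \<pi> borel snd = \<nu>}"

text \<open>
  The infimum below is over a nonempty set of nonnegative reals when both measures are Borel
  probability measures, and the integrals are those of integrable functions when both have
  finite second moment. The infimum is then attained, i.e. it is the usual minimum.
\<close>

definition wasserstein2 :: "(real ^ 'n) measure \<Rightarrow> (real ^ 'n) measure \<Rightarrow> real" where
  "wasserstein2 \<mu> \<nu> = sqrt (INF \<pi>\<in>couplings \<mu> \<nu>. LINT z|\<pi>. (norm (fst z - snd z))\<^sup>2)"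

definition hellinger :: "real ^ 'n \<Rightarrow> real ^ 'n \<Rightarrow> real" where
  "hellinger x y = norm ((\<chi> i. sqrt (x $ i)) - (\<chi> i. sqrt (y $ i)))"

text \<open>
  The metric space is given by its carrier \<open>Y\<close> and its distance \<open>d\<close>; \<open>g\<close> is only
  evaluated on \<open>Y\<close>. As \<open>g\<close> need not be bounded below, the envelope may be \<open>-\<infinity>\<close>.
\<close>

definition moreau_envelope ::
  "'a set \<Rightarrow> ('a \<Rightarrow> 'a \<Rightarrow> real) \<Rightarrow> real \<Rightarrow> ('a \<Rightarrow> ereal) \<Rightarrow> 'a \<Rightarrow> ereal" where
  "moreau_envelope Y d \<rho> g y = (INF y'\<in>Y. g y' + ereal (1 / (2 * \<rho>) * (d y y')\<^sup>2))"

end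

theory Submission
  imports Defs
begin

text \<open>
  Both inequalities compare \<open>W\<^sub>2(\<mu>, \<nu>)\<close> with the Hellinger distance of the spectra \<open>a\<close> and \<open>b\<close> of the
  covariances. For a coupling \<open>(X, Y)\<close>, expand \<open>X\<close> and \<open>Y\<close> in eigenbases \<open>u\<close> and \<open>v\<close>. Then
  \<open>E (X \<bullet> Y)\<close> is the sum over \<open>i, j\<close> of \<open>sqrt (a i) * sqrt (b j) * M i j * R i j\<close>, where \<open>M\<close> is the matrix of
  correlations of the normalised coordinates and \<open>R i j = u i \<bullet> v j\<close>. By Bessel's inequality and
  orthogonality the entries \<open>(M i j ^ 2 + R i j ^ 2) / 2\<close> have row and column sums at most 1, so the
  sum is at most that of \<open>sqrt (a i) * sqrt (b i)\<close>, whence \<open>E |X - Y|^2\<close> is at least the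
  squared Hellinger distance.

  Conversely, for a nonnegative vector \<open>x\<close>, let \<open>Y\<close> have coordinates \<open>sqrt (x i / a i) * (u i \<bullet> X)\<close> where
  \<open>a i > 0\<close>, and where \<open>a i = 0\<close> uncorrelated noise of variance \<open>x i\<close>, independent of \<open>X\<close>. Its covariance has
  spectrum \<open>x\<close> up to order, which the symmetric \<open>f\<close> does not see, and \<open>E |X - Y|^2\<close> is exactly the squared
  Hellinger distance of \<open>a\<close> and \<open>x\<close>.
\<close>

section \<open>Diagonalisation of symmetric matrices\<close>

text \<open>Near \<open>t = 0\<close> the linear term dominates, so if \<open>a\<close> were
  nonzero, one sign of \<open>t\<close> would give a negative value. At
  \<open>t = - a / (\<bar>b\<bar> + 1)\<close> the value is the square of \<open>a\<close> times a
  negative number; the added 1 keeps this strict also for \<open>b = 0\<close>.\<close>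

lemma linear_term_eq_0:
  fixes a b :: real
  assumes "\<And>t. 0 \<le> t * a + t\<^sup>2 * b"
  shows "a = 0"
proof -
  have "0 \<le> (- a / (\<bar>b\<bar> + 1)) * a + (- a / (\<bar>b\<bar> + 1))\<^sup>2 * b"
    by (rule assms)
  also have "\<dots> = a\<^sup>2 * (b - (\<bar>b\<bar> + 1)) / (\<bar>b\<bar> + 1)\<^sup>2"
    by (simp add: divide_simps power2_eq_square) (auto simp: algebra_simps)
  finally have "0 \<le> a\<^sup>2 * (b - (\<bar>b\<bar> + 1))"
    by (auto simp: zero_le_divide_iff)
  moreover have "b - (\<bar>b\<bar> + 1) < 0" by linarith
  ultimately show "a = 0"
    by (metis mult_pos_neg not_less zero_less_power2)
qed

text \<open>The Rayleigh quotient attains its maximum on the compact unit sphere of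
  \<open>S\<close>. At a maximiser its first variation vanishes, which is the eigenvector
  equation.\<close>

lemma self_adjoint_eigenvector_exists:
  fixes f :: "'a::euclidean_space \<Rightarrow> 'a"
  assumes lin: "linear f" and sa: "\<And>x y. f x \<bullet> y = x \<bullet> f y"
    and S: "subspace S" "\<And>x. x \<in> S \<Longrightarrow> f x \<in> S" "S \<noteq> {0}"
  obtains e c where "e \<in> S" "norm e = 1" "f e = c *\<^sub>R e"
proof -
  let ?K = "S \<inter> sphere 0 1"
  obtain z where z: "z \<in> S" "z \<noteq> 0"
    using S subspace_0 by blast
  then have "z /\<^sub>R norm z \<in> ?K"
    using S(1) by (auto simp: subspace_scale)
  moreover have "compact ?K"
    using S(1) by (simp add: closed_Int_compact closed_subspace)
  moreover have "continuous_on ?K (\<lambda>x. x \<bullet> f x)"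
    using lin by (intro continuous_intros linear_continuous_on linear_conv_bounded_linear[THEN iffD1])
  ultimately obtain e where e: "e \<in> ?K" and max: "\<And>x. x \<in> ?K \<Longrightarrow> x \<bullet> f x \<le> e \<bullet> f e"
    by (metis continuous_attains_sup empty_iff)
  define m where "m = e \<bullet> f e"
  \<comment> \<open>By homogeneity the bound on the unit sphere extends to all of \<open>S\<close>,
    so it can be tested along a line through \<open>e\<close>.\<close>
  have q: "0 \<le> m * (x \<bullet> x) - x \<bullet> f x" if "x \<in> S" for x
  proof (cases "x = 0")
    case False
    then have "(x /\<^sub>R norm x) \<bullet> f (x /\<^sub>R norm x) \<le> m"
      unfolding m_def using that S(1) by (intro max) (auto simp: subspace_scale)
    also have "(x /\<^sub>R norm x) \<bullet> f (x /\<^sub>R norm x) = (x \<bullet> f x) / (x \<bullet> x)"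
      by (simp add: linear_scale[OF lin] dot_square_norm power2_eq_square field_simps)
    finally show ?thesis
      using False by (simp add: field_simps)
  qed (simp add: linear_0[OF lin])
  have ee: "e \<bullet> e = 1" "e \<in> S"
    using e by (auto simp: dot_square_norm)
  \<comment> \<open>The residual \<open>w\<close> lies in \<open>S\<close> by invariance. Perturbing
    \<open>e\<close> in the direction \<open>w\<close> gives a nonnegative polynomial in
    \<open>t\<close> with linear coefficient \<open>2 * (w \<bullet> w)\<close>, which forces
    \<open>w = 0\<close>.\<close>
  define w where "w = m *\<^sub>R e - f e"
  have w: "w \<in> S"
    unfolding w_def using S ee by (intro subspace_diff subspace_scale) auto
  have "2 * (w \<bullet> w) = 0"
  proof (rule linear_term_eq_0)
    fix t :: real
    have "0 \<le> m * ((e + t *\<^sub>R w) \<bullet> (e + t *\<^sub>R w)) - (e + t *\<^sub>R w) \<bullet> f (e + t *\<^sub>R w)"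
      using S(1) ee w by (intro q subspace_add subspace_scale) auto
    also have "\<dots> = t * (2 * (w \<bullet> (m *\<^sub>R e - f e))) + t\<^sup>2 * (m * (w \<bullet> w) - w \<bullet> f w)"
      using sa[of e w] ee(1)
      by (simp add: linear_add[OF lin] linear_scale[OF lin] inner_simps inner_commute m_def
          power2_eq_square algebra_simps)
    finally show "0 \<le> t * (2 * (w \<bullet> w)) + t\<^sup>2 * (m * (w \<bullet> w) - w \<bullet> f w)"
      by (simp only: w_def)
  qed
  then have "f e = m *\<^sub>R e"
    by (simp add: w_def)
  with that ee e show thesis
    by auto
qed

text \<open>Eigenvectors are added one at a time. Self-adjointness makes the orthogonal complement
  of those already found invariant, and it is nontrivial as long as there are fewer than
  \<open>DIM('a)\<close> of them.\<close>

lemma self_adjoint_eigenbasis_exists: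
  fixes f :: "'a::euclidean_space \<Rightarrow> 'a"
  assumes lin: "linear f" and sa: "\<And>x y. f x \<bullet> y = x \<bullet> f y"
  shows "k \<le> DIM('a) \<Longrightarrow> \<exists>B. finite B \<and> card B = k \<and> (\<forall>b\<in>B. norm b = 1 \<and> (\<exists>c. f b = c *\<^sub>R b)) \<and>
    (\<forall>a\<in>B. \<forall>b\<in>B. a \<noteq> b \<longrightarrow> a \<bullet> b = 0)"
proof (induction k)
  case 0
  then show ?case by (intro exI[of _ "{}"]) auto
next
  case (Suc k)
  then obtain B where B: "finite B" "card B = k" "\<And>b. b \<in> B \<Longrightarrow> norm b = 1"
    "\<And>b. b \<in> B \<Longrightarrow> \<exists>c. f b = c *\<^sub>R b" "\<And>a b. a \<in> B \<Longrightarrow> b \<in> B \<Longrightarrow> a \<noteq> b \<Longrightarrow> a \<bullet> b = 0"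
    by auto
  define S where "S = {x. \<forall>b\<in>B. b \<bullet> x = 0}"
  have sub: "subspace S"
    by (auto simp: S_def subspace_def inner_simps)
  have "f x \<in> S" if "x \<in> S" for x
    unfolding S_def
  proof (clarify)
    fix b assume b: "b \<in> B"
    then obtain c where "f b = c *\<^sub>R b" using B by blast
    then show "b \<bullet> f x = 0"
      using that b sa[of b x] by (simp add: S_def)
  qed
  moreover have "S \<noteq> {0}"
  proof -
    have "dim (span B) < DIM('a)"
      using dim_le_card[of B B] B(1,2) Suc.prems by (simp add: span_superset dim_span)
    then obtain x where "x \<noteq> 0" "\<And>y. y \<in> span B \<Longrightarrow> orthogonal x y"
      by (metis orthogonal_to_subspace_exists dim_span span_span)
    then have "x \<in> S"
      by (auto simp: S_def orthogonal_def span_base inner_commute)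
    with \<open>x \<noteq> 0\<close> show ?thesis by blast
  qed
  ultimately obtain e c where e: "e \<in> S" "norm e = 1" "f e = c *\<^sub>R e"
    using self_adjoint_eigenvector_exists[OF lin sa sub] by metis
  have "e \<notin> B"
  proof
    assume "e \<in> B"
    then have "e \<bullet> e = 0" using e(1) by (simp add: S_def)
    with e(2) show False by auto
  qed
  with B e show ?case
    by (intro exI[of _ "insert e B"]) (auto simp: S_def inner_commute)
qed

section \<open>Orthonormal bases and the characteristic polynomial\<close>

definition orthonormal_family :: "('n \<Rightarrow> real ^ 'n) \<Rightarrow> bool" where
  "orthonormal_family u \<longleftrightarrow> (\<forall>i j. u i \<bullet> u j = (if i = j then 1 else 0))"

lemma orthonormal_family_inner:
  "orthonormal_family u \<Longrightarrow> u i \<bullet> u j = (if i = j then 1 else 0)"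
  by (simp add: orthonormal_family_def)

text \<open>The family is indexed by the coordinate type, so the matrix with rows \<open>u i\<close>
  is square and orthonormality of its rows already makes it orthogonal.\<close>

lemma orthonormal_family_matrix:
  fixes u :: "'n \<Rightarrow> real ^ 'n"
  assumes "orthonormal_family u"
  shows "orthogonal_matrix (\<chi> i. u i)"
proof -
  have "orthogonal_matrix (transpose (\<chi> i. u i))"
    unfolding orthogonal_matrix using assms
    by (simp add: vec_eq_iff matrix_matrix_mult_def transpose_def mat_def orthonormal_family_def
        inner_vec_def)
  then show ?thesis
    by simp
qed

lemma orthonormal_family_parseval:
  fixes u :: "'n \<Rightarrow> real ^ 'n"
  assumes "orthonormal_family u"
  shows "x \<bullet> y = (\<Sum>i\<in>UNIV. (u i \<bullet> x) * (u i \<bullet> y))"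
proof -
  let ?Q = "\<chi> i. u i"
  have "x \<bullet> y = (?Q *v x) \<bullet> (?Q *v y)"
    using orthonormal_family_matrix[OF assms]
    by (metis matrix_vector_mul_linear matrix_of_matrix_vector_mul orthogonal_transformation_def
        orthogonal_transformation_matrix)
  also have "\<dots> = (\<Sum>i\<in>UNIV. (u i \<bullet> x) * (u i \<bullet> y))"
    by (simp add: inner_vec_def matrix_vector_mult_def)
  finally show ?thesis .
qed

text \<open>Conjugating by the orthogonal matrix with rows \<open>u i\<close> preserves the
  determinant and makes \<open>mat t - A\<close> diagonal. The entries of \<open>v\<close> may come
  in any order.\<close>

lemma det_mat_minus_diagonalised:
  fixes A :: "real ^ 'n ^ 'n" and u :: "'n \<Rightarrow> real ^ 'n"
  assumes u: "orthonormal_family u"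
    and A: "\<And>i j. u i \<bullet> (A *v u j) = (if i = j then v $ i else 0)"
  shows "det (mat t - A) = (\<Prod>i\<in>UNIV. t - v $ i)"
proof -
  let ?Q = "\<chi> i. u i"
  have Q: "det ?Q * det ?Q = 1"
    using det_orthogonal_matrix[OF orthonormal_family_matrix[OF u]] by auto
  have entry: "(?Q ** M ** transpose ?Q) $ i $ j = u i \<bullet> (M *v u j)" for M i j
    by (simp add: matrix_matrix_mult_def transpose_def inner_vec_def matrix_vector_mult_def
        sum_distrib_left sum_distrib_right mult.assoc) (rule sum.swap)
  have "det (mat t - A) = det (?Q ** (mat t - A) ** transpose ?Q)"
    using Q by (simp add: det_mul)
  also have "\<dots> = (\<Prod>i\<in>UNIV. (?Q ** (mat t - A) ** transpose ?Q) $ i $ i)"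
  proof (rule det_diagonal)
    fix i j :: 'n assume "i \<noteq> j"
    moreover have "mat t *v u j = t *\<^sub>R u j"
      by (simp add: vec_eq_iff matrix_vector_mult_def mat_def if_distrib if_distribR cong: if_cong)
    ultimately show "(?Q ** (mat t - A) ** transpose ?Q) $ i $ j = 0"
      by (simp add: entry matrix_vector_mult_diff_rdistrib inner_diff_right A orthonormal_family_inner[OF u])
  qed
  also have "\<dots> = (\<Prod>i\<in>UNIV. t - v $ i)"
  proof (rule prod.cong[OF refl])
    fix i :: 'n
    have "mat t *v u i = t *\<^sub>R u i"
      by (simp add: vec_eq_iff matrix_vector_mult_def mat_def if_distrib if_distribR cong: if_cong)
    then show "(?Q ** (mat t - A) ** transpose ?Q) $ i $ i = t - v $ i"
      by (simp add: entry matrix_vector_mult_diff_rdistrib inner_diff_right A orthonormal_family_inner[OF u])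
  qed
  finally show ?thesis .
qed

section \<open>Sorted spectra and their uniqueness\<close>

lemma finite_lower_sets_eqI:
  fixes S T :: "'n::{finite, linorder} set"
  assumes "card S = card T" "\<And>i j. i \<le> j \<Longrightarrow> j \<in> S \<Longrightarrow> i \<in> S" "\<And>i j. i \<le> j \<Longrightarrow> j \<in> T \<Longrightarrow> i \<in> T"
  shows "S = T"
proof -
  \<comment> \<open>Lower sets of a linear order are nested, so their size determines them.\<close>
  have "S \<subseteq> T \<or> T \<subseteq> S"
    using assms(2,3) by (metis linear subsetI)
  then show ?thesis
    using assms(1) by (metis card_subset_eq finite)
qed

text \<open>Uniqueness behind the \<open>THE\<close> in \<open>eigenvalue_vector\<close>. Equal
  polynomials have equal root multisets, so corresponding superlevel sets of \<open>v\<close> and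
  \<open>w\<close> have equal size. Being lower sets they coincide, and they determine the
  vectors.\<close>

lemma nonincreasing_eq_if_same_prod:
  fixes v w :: "real ^ ('n::{finite, linorder})"
  assumes v: "\<And>i j. i \<le> j \<Longrightarrow> v $ j \<le> v $ i" and w: "\<And>i j. i \<le> j \<Longrightarrow> w $ j \<le> w $ i"
    and eq: "\<And>t. (\<Prod>i\<in>UNIV. t - v $ i) = (\<Prod>i\<in>UNIV. t - w $ i)"
  shows "v = w"
proof -
  have proots: "proots (\<Prod>i\<in>UNIV. [:- x $ i, 1:]) = image_mset (($) x) (mset_set UNIV)"
    for x :: "real ^ ('n :: {finite, linorder})"
    by (subst proots_prod) (auto simp: sum_unfold_sum_mset)
  have "poly (\<Prod>i\<in>UNIV. [:- v $ i, 1:]) = poly (\<Prod>i\<in>UNIV. [:- w $ i, 1:])"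
    using eq by (intro ext) (simp add: poly_prod)
  then have ms: "image_mset (($) v) (mset_set UNIV) = image_mset (($) w) (mset_set UNIV)"
    by (metis poly_eq_poly_eq_iff proots)
  have "{i. a \<le> v $ i} = {i. a \<le> w $ i}" for a
  proof (rule finite_lower_sets_eqI)
    have "size (filter_mset ((\<le>) a) (image_mset (($) x) (mset_set UNIV))) = card {i. a \<le> x $ i}"
      for x :: "real ^ ('n :: {finite, linorder})"
      by (simp add: filter_mset_image_mset o_def)
    then show "card {i. a \<le> v $ i} = card {i. a \<le> w $ i}"
      using ms by metis
  qed (use v w in \<open>force+\<close>)
  then show ?thesis
    by (metis (mono_tags) mem_Collect_eq antisym order_refl vec_eq_iff)
qed

lemma eigenvalue_vector_eqI:
  fixes A :: "real ^ ('n::{finite, linorder}) ^ ('n::{finite, linorder})"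
  assumes "\<And>i j. i \<le> j \<Longrightarrow> v $ j \<le> v $ i" "\<And>t. det (mat t - A) = (\<Prod>i\<in>UNIV. t - v $ i)"
  shows "eigenvalue_vector A = v"
  unfolding eigenvalue_vector_def
  by (rule the_equality) (use assms in \<open>auto intro!: nonincreasing_eq_if_same_prod\<close>)

lemma nonincreasing_permutation_exists:
  fixes x :: "'n::{finite, linorder} \<Rightarrow> real"
  obtains p where "p permutes UNIV" "\<And>i j. i \<le> j \<Longrightarrow> x (p j) \<le> x (p i)"
proof -
  \<comment> \<open>\<open>xs\<close> lists the indices in increasing order, \<open>ys\<close> by
    nonincreasing \<open>x\<close>. The permutation sends the index at a position of
    \<open>xs\<close> to the index at the same position of \<open>ys\<close>.\<close>
  define xs where "xs = sorted_list_of_set (UNIV :: 'n set)"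
  define ys where "ys = sort_key (\<lambda>i. - x i) xs"
  have xs: "distinct xs" "set xs = UNIV" "sorted xs" by (auto simp: xs_def)
  have ys: "distinct ys" "set ys = UNIV" "length ys = length xs" 
    "sorted (map (\<lambda>i. - x i) ys)" by (auto simp: ys_def xs)
  have "\<exists>k<length xs. xs ! k = i" for i
    using xs(2) by (metis UNIV_I in_set_conv_nth)
  then obtain k where k: "\<And>i. k i < length xs" "\<And>i. xs ! k i = i"
    by metis
  show thesis
  proof (rule that[of "\<lambda>i. ys ! k i"])
    have "inj (\<lambda>i. ys ! k i)"
      using k(1) ys(1,3) by (intro injI) (metis k(2) nth_eq_iff_index_eq)
    then show "(\<lambda>i. ys ! k i) permutes UNIV"
      by (intro bij_imp_permutes) (auto simp: bij_def finite_UNIV_inj_surj)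
    fix i j :: 'n assume "i \<le> j"
    have "k i \<le> k j"
    proof (rule ccontr)
      assume "\<not> k i \<le> k j"
      then have "xs ! k j \<le> xs ! k i"
        using k(1) xs(3) by (intro sorted_nth_mono) auto
      with \<open>i \<le> j\<close> \<open>\<not> k i \<le> k j\<close> show False
        by (simp add: k(2))
    qed
    then show "x (ys ! k j) \<le> x (ys ! k i)"
      using sorted_nth_mono[OF ys(4), of "k i" "k j"] k(1) ys(3) by simp
  qed
qed

text \<open>Meant for a covariance built with a prescribed diagonal \<open>x\<close>, which need not
  be sorted; \<open>p\<close> is the sorting permutation.\<close>

lemma eigenvalue_vector_permuted:
  fixes A :: "real ^ ('n::{finite, linorder}) ^ ('n::{finite, linorder})"
  assumes "orthonormal_family u"
    and "\<And>i j. u i \<bullet> (A *v u j) = (if i = j then x $ i else 0)"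
  obtains p where "p permutes UNIV" "eigenvalue_vector A = (\<chi> i. x $ p i)"
proof -
  obtain p where p: "p permutes (UNIV::'n set)" "\<And>i j. i \<le> j \<Longrightarrow> x $ (p j) \<le> x $ (p i)"
    using nonincreasing_permutation_exists by blast
  have "eigenvalue_vector A = (\<chi> i. x $ p i)"
  proof (rule eigenvalue_vector_eqI)
    fix t
    have "det (mat t - A) = (\<Prod>i\<in>UNIV. t - x $ i)"
      using assms by (rule det_mat_minus_diagonalised)
    also have "\<dots> = (\<Prod>i\<in>UNIV. t - x $ p i)"
      by (rule prod.reindex_bij_betw[OF permutes_imp_bij[OF p(1)], symmetric])
    finally show "det (mat t - A) = (\<Prod>i\<in>UNIV. t - (\<chi> i. x $ p i) $ i)" by simp
  qed (use p in simp)
  with p(1) that show thesis by blast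
qed

lemma symmetric_matrix_eigenbasis:
  fixes A :: "real ^ ('n::{finite, linorder}) ^ ('n::{finite, linorder})"
  assumes "transpose A = A"
  obtains u where "orthonormal_family u"
    "\<And>i j. u i \<bullet> (A *v u j) = (if i = j then eigenvalue_vector A $ i else 0)"
    "\<And>i j. i \<le> j \<Longrightarrow> eigenvalue_vector A $ j \<le> eigenvalue_vector A $ i"
proof -
  have "(A *v x) \<bullet> y = x \<bullet> (A *v y)" for x y
    by (metis assms dot_lmul_matrix vector_transpose_matrix)
  with self_adjoint_eigenbasis_exists[of "(*v) A" "CARD('n)"]
  obtain B where B: "finite B" "card B = CARD('n)"
    "\<forall>b\<in>B. norm b = 1 \<and> (\<exists>c. A *v b = c *\<^sub>R b)" "\<forall>a\<in>B. \<forall>b\<in>B. a \<noteq> b \<longrightarrow> a \<bullet> b = 0"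
    by auto
  obtain h where h: "bij_betw h (UNIV :: 'n set) B"
    using B(1,2) finite_same_card_bij[of "UNIV :: 'n set" B] by auto
  from B(3) obtain c where c: "\<And>b. b \<in> B \<Longrightarrow> A *v b = c b *\<^sub>R b" by metis
  obtain p where p: "p permutes (UNIV::'n set)" "\<And>i j. i \<le> j \<Longrightarrow> c (h (p j)) \<le> c (h (p i))"
    using nonincreasing_permutation_exists[of "c \<circ> h"] by auto
  \<comment> \<open>Enumerating the eigenvectors by nonincreasing eigenvalue makes the diagonal
    equal to \<open>eigenvalue_vector A\<close> itself, with no permutation left over.\<close>
  define u where "u i = h (p i)" for i
  have uB: "u i \<in> B" for i using h by (auto simp: u_def bij_betw_def)
  have uinj: "u i = u j \<longleftrightarrow> i = j" for i j
    using h p(1) by (auto simp: u_def bij_betw_def inj_on_def dest: permutes_inj)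
  have on: "orthonormal_family u"
    unfolding orthonormal_family_def using B(3,4) uB uinj by (auto simp: dot_square_norm)
  have diag: "u i \<bullet> (A *v u j) = (if i = j then (\<chi> i. c (u i)) $ i else 0)" for i j
    using c[OF uB[of j]] by (simp add: orthonormal_family_inner[OF on])
  have ev: "eigenvalue_vector A = (\<chi> i. c (u i))"
    by (intro eigenvalue_vector_eqI det_mat_minus_diagonalised[OF on diag]) (simp add: u_def p(2))
  show thesis
  proof (rule that[OF on])
    show "u i \<bullet> (A *v u j) = (if i = j then eigenvalue_vector A $ i else 0)" for i j
      unfolding ev by (rule diag)
    show "eigenvalue_vector A $ j \<le> eigenvalue_vector A $ i" if "i \<le> j" for i j
      using p(2)[OF that] by (simp add: ev u_def)
  qed
qed

section \<open>Bilinear forms with substochastic coefficients\<close>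

text \<open>Peel off the minimal positive value on the support, which is a lower set.\<close>

lemma nonincreasing_induct [consumes 2, case_names zero add]:
  fixes s :: "'n::{finite, linorder} \<Rightarrow> real"
  assumes "antimono s" "\<forall>i. 0 \<le> s i"
    and zero: "P (\<lambda>_. 0)"
    and add: "\<And>s S c. P s \<Longrightarrow> (\<And>i j. i \<le> j \<Longrightarrow> j \<in> S \<Longrightarrow> i \<in> S) \<Longrightarrow> 0 \<le> c \<Longrightarrow>
      P (\<lambda>i. s i + c * of_bool (i \<in> S))"
  shows "P s"
  using assms(1,2)
proof (induction "card {i. 0 < s i}" arbitrary: s rule: less_induct)
  case less
  have anti: "s j \<le> s i" if "i \<le> j" for i j
    using less.prems(1) that by (rule antimonoD)
  have nonneg: "0 \<le> s i" for i
    using less.prems(2) by blast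
  define S where "S = {i. 0 < s i}"
  show ?case
  proof (cases "S = {}")
    case True
    then have "s = (\<lambda>_. 0)"
      using nonneg by (intro ext) (simp add: S_def set_eq_iff not_less order.antisym)
    then show ?thesis using zero by simp
  next
    case False
    define c where "c = Min (s ` S)"
    have c: "c \<in> s ` S" "\<And>i. i \<in> S \<Longrightarrow> c \<le> s i"
      using False by (auto simp: c_def)
    then have "0 < c" by (auto simp: S_def)
    let ?s = "\<lambda>i. s i - c * of_bool (i \<in> S)"
    have lower: "i \<in> S" if "i \<le> j" "j \<in> S" for i j
      using anti[OF that(1)] that(2) by (simp add: S_def)
    \<comment> \<open>An index attaining the minimum leaves the support, so the cardinality that
      drives the induction drops strictly.\<close>
    obtain i0 where i0: "i0 \<in> S" "s i0 = c"
      using c(1) by blast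
    have "i \<in> S" if "0 < ?s i" for i
      using that by (cases "i \<in> S") (simp_all add: S_def)
    moreover have "\<not> 0 < ?s i0"
      using i0 by simp
    ultimately have "{i. 0 < ?s i} \<subset> S"
      using i0(1) by blast
    then have "card {i. 0 < ?s i} < card {i. 0 < s i}"
      by (metis S_def finite psubset_card_mono)
    moreover have "?s j \<le> ?s i" if "i \<le> j" for i j
    \<comment> \<open>If \<open>j\<close> is in \<open>S\<close>, then so is \<open>i\<close>, and
      both values lose \<open>c\<close>. Otherwise \<open>s j = 0\<close>, and the reduced value at
      \<open>i\<close> is still nonnegative.\<close>
    proof (cases "j \<in> S")
      case True
      then show ?thesis
        using anti[OF that] lower[OF that] by simp
    next
      case False
      then have "s j = 0"
        using nonneg[of j] by (simp add: S_def)
      then show ?thesis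
        using False c(2)[of i] nonneg[of i] by (cases "i \<in> S") simp_all
    qed
    moreover have "0 \<le> ?s i" for i
      using c(2)[of i] nonneg[of i] by (cases "i \<in> S") simp_all
    ultimately have "P ?s"
      by (intro less.hyps antimonoI allI)
    from add[where c = c, OF this lower] \<open>0 < c\<close> show ?thesis by simp
  qed
qed


text \<open>One of the two lower sets contains the other, so the smaller one is the intersection.
  Bounding the row sums over \<open>S\<close> or the column sums over \<open>T\<close> by 1,
  whichever set is smaller, gives its size.\<close>

lemma substochastic_rectangle_le:
  fixes D :: "'n::{finite, linorder} \<Rightarrow> 'n \<Rightarrow> real"
  assumes D: "\<And>i j. 0 \<le> D i j" "\<And>i. (\<Sum>j\<in>UNIV. D i j) \<le> 1" "\<And>j. (\<Sum>i\<in>UNIV. D i j) \<le> 1"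
    and S: "\<And>i j. i \<le> j \<Longrightarrow> j \<in> S \<Longrightarrow> i \<in> S" and T: "\<And>i j. i \<le> j \<Longrightarrow> j \<in> T \<Longrightarrow> i \<in> T"
  shows "(\<Sum>i\<in>S. \<Sum>j\<in>T. D i j) \<le> real (card (S \<inter> T))"
proof -
  have row: "(\<Sum>j\<in>T. D i j) \<le> 1" for i
    using sum_mono2[of UNIV T "D i"] D(1) D(2)[of i] by auto
  have col: "(\<Sum>i\<in>S. D i j) \<le> 1" for j
    using sum_mono2[of UNIV S "\<lambda>i. D i j"] D(1) D(3)[of j] by auto
  consider "S \<subseteq> T" | "T \<subseteq> S"
  proof (cases "S \<subseteq> T")
    case False
    then obtain i where "i \<in> S" "i \<notin> T" by blast
    have "j \<in> S" if "j \<in> T" for j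
    proof (rule S)
      show "j \<le> i"
        using T[OF _ that] \<open>i \<notin> T\<close> by (metis linorder_le_cases)
    qed (fact \<open>i \<in> S\<close>)
    then have "T \<subseteq> S" by blast
    with that show thesis by blast
  qed (use that in blast)
  then show ?thesis
  proof cases
    case 1
    have "(\<Sum>i\<in>S. \<Sum>j\<in>T. D i j) \<le> (\<Sum>i\<in>S. 1)"
      using row by (rule sum_mono)
    with 1 show ?thesis by (simp add: Int_absorb2)
  next
    case 2
    have "(\<Sum>i\<in>S. \<Sum>j\<in>T. D i j) = (\<Sum>j\<in>T. \<Sum>i\<in>S. D i j)"
      by (rule sum.swap)
    also have "\<dots> \<le> (\<Sum>j\<in>T. 1)"
      using col by (rule sum_mono)
    finally show ?thesis using 2 by (simp add: Int_absorb1)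
  qed
qed

text \<open>Both sides are bilinear in \<open>s\<close> and \<open>t\<close>, and nonnegative
  nonincreasing vectors are nonnegative combinations of indicators of lower sets. This reduces the
  claim to rectangles, without decomposing \<open>D\<close> into permutation matrices.\<close>

lemma substochastic_form_le:
  fixes D :: "'n::{finite, linorder} \<Rightarrow> 'n \<Rightarrow> real"
  assumes s: "antimono s" "\<forall>i. 0 \<le> s i"
    and t: "antimono t" "\<forall>i. 0 \<le> t i"
    and D: "\<And>i j. 0 \<le> D i j" "\<And>i. (\<Sum>j\<in>UNIV. D i j) \<le> 1" "\<And>j. (\<Sum>i\<in>UNIV. D i j) \<le> 1"
  shows "(\<Sum>i\<in>UNIV. \<Sum>j\<in>UNIV. s i * t j * D i j) \<le> (\<Sum>i\<in>UNIV. s i * t i)"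
  using t
proof (induction t rule: nonincreasing_induct)
  case (add t T c)
  note lower = add.hyps(1)
  \<comment> \<open>With \<open>t\<close> reduced to the indicator of \<open>T\<close>, a second
    induction reduces \<open>s\<close> to the indicator of \<open>S\<close>.\<close>
  from s have "(\<Sum>i\<in>UNIV. \<Sum>j\<in>UNIV. s i * of_bool (j \<in> T) * D i j) \<le> (\<Sum>i\<in>UNIV. s i * of_bool (i \<in> T))"
  proof (induction s rule: nonincreasing_induct)
    case (add s S d)
    have restrict: "(\<Sum>i\<in>UNIV. \<Sum>j\<in>UNIV. of_bool (i \<in> S) * of_bool (j \<in> T) * D i j) = (\<Sum>i\<in>S. \<Sum>j\<in>T. D i j)"
      by (simp add: mult.assoc flip: sum_distrib_left)
    have card: "(\<Sum>i\<in>UNIV. of_bool (i \<in> S) * of_bool (i \<in> T)) = real (card (S \<inter> T))"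
      by (simp add: Int_commute)
    have "(\<Sum>i\<in>S. \<Sum>j\<in>T. D i j) \<le> real (card (S \<inter> T))"
      by (rule substochastic_rectangle_le[OF D add.hyps(1) lower])
    then have le: "d * (\<Sum>i\<in>UNIV. \<Sum>j\<in>UNIV. of_bool (i \<in> S) * of_bool (j \<in> T) * D i j) \<le>
        d * (\<Sum>i\<in>UNIV. of_bool (i \<in> S) * of_bool (i \<in> T))"
      unfolding restrict card using \<open>0 \<le> d\<close> by (rule mult_left_mono)
    have lin: "(\<Sum>i\<in>UNIV. \<Sum>j\<in>UNIV. (s i + d * g i) * h j * D i j) =
        (\<Sum>i\<in>UNIV. \<Sum>j\<in>UNIV. s i * h j * D i j) + d * (\<Sum>i\<in>UNIV. \<Sum>j\<in>UNIV. g i * h j * D i j)"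
      "(\<Sum>i\<in>UNIV. (s i + d * g i) * h i) = (\<Sum>i\<in>UNIV. s i * h i) + d * (\<Sum>i\<in>UNIV. g i * h i)"
      for g h :: "'n \<Rightarrow> real"
      by (simp_all add: distrib_right sum.distrib sum_distrib_left mult.assoc)
    show ?case
      unfolding lin by (rule add_mono[OF add.IH le])
  qed simp
  then have le: "c * (\<Sum>i\<in>UNIV. \<Sum>j\<in>UNIV. s i * of_bool (j \<in> T) * D i j) \<le> c * (\<Sum>i\<in>UNIV. s i * of_bool (i \<in> T))"
    using \<open>0 \<le> c\<close> by (rule mult_left_mono)
  have lin: "(\<Sum>i\<in>UNIV. \<Sum>j\<in>UNIV. s i * (t j + c * h j) * D i j) =
      (\<Sum>i\<in>UNIV. \<Sum>j\<in>UNIV. s i * t j * D i j) + c * (\<Sum>i\<in>UNIV. \<Sum>j\<in>UNIV. s i * h j * D i j)"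
    "(\<Sum>i\<in>UNIV. s i * (t i + c * h i)) = (\<Sum>i\<in>UNIV. s i * t i) + c * (\<Sum>i\<in>UNIV. s i * h i)"
    for h :: "'n \<Rightarrow> real"
    by (simp_all add: distrib_right distrib_left sum.distrib sum_distrib_left mult.assoc mult.left_commute)
  show ?case
    unfolding lin by (rule add_mono[OF add.IH le])
qed simp

text \<open>In the application \<open>c\<close> holds cross moments of coordinates with variances
  \<open>a\<close> and \<open>b\<close>, and \<open>r\<close> the inner products of two orthonormal
  bases. The arithmetic-geometric mean inequality separates the two.\<close>

lemma cross_trace_le:
  fixes a b :: "'n::{finite, linorder} \<Rightarrow> real"
  assumes a: "antimono a" "\<And>i. 0 \<le> a i"
    and b: "antimono b" "\<And>i. 0 \<le> b i"
    and c: "\<And>i. (\<Sum>j\<in>UNIV. (c i j)\<^sup>2 / b j) \<le> a i" "\<And>j. (\<Sum>i\<in>UNIV. (c i j)\<^sup>2 / a i) \<le> b j"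
      "\<And>i j. a i = 0 \<or> b j = 0 \<Longrightarrow> c i j = 0"
    and r: "\<And>i. (\<Sum>j\<in>UNIV. (r i j)\<^sup>2) \<le> 1" "\<And>j. (\<Sum>i\<in>UNIV. (r i j)\<^sup>2) \<le> 1"
  shows "(\<Sum>i\<in>UNIV. \<Sum>j\<in>UNIV. c i j * r i j) \<le> (\<Sum>i\<in>UNIV. sqrt (a i) * sqrt (b i))"
proof -
  \<comment> \<open>The mean of a squared correlation and a squared inner product. The hypotheses on
    \<open>c\<close> and \<open>r\<close> bound the row and column sums of each part by 1.\<close>
  define D where "D i j = ((c i j)\<^sup>2 / (a i * b j) + (r i j)\<^sup>2) / 2" for i j
  have "c i j * r i j \<le> sqrt (a i) * sqrt (b j) * D i j" for i j
  proof (cases "a i = 0 \<or> b j = 0")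
    case False
    define s where "s = sqrt (a i) * sqrt (b j)"
    have s: "0 < s" "a i * b j = s\<^sup>2"
      using False a(2)[of i] b(2)[of j] by (auto simp: s_def power_mult_distrib order_less_le)
    have "0 \<le> s * (c i j / s - r i j)\<^sup>2"
      using s by simp
    then have "c i j * r i j \<le> s * (((c i j)\<^sup>2 / s\<^sup>2 + (r i j)\<^sup>2) / 2)"
      using s by (simp add: power2_eq_square field_simps)
    then show ?thesis
      by (simp add: D_def s flip: s_def)
  qed (use c(3) in auto)
  then have "(\<Sum>i\<in>UNIV. \<Sum>j\<in>UNIV. c i j * r i j) \<le> (\<Sum>i\<in>UNIV. \<Sum>j\<in>UNIV. sqrt (a i) * sqrt (b j) * D i j)"
    by (intro sum_mono)
  also have "\<dots> \<le> (\<Sum>i\<in>UNIV. sqrt (a i) * sqrt (b i))"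
  proof (rule substochastic_form_le)
    show "(\<Sum>j\<in>UNIV. D i j) \<le> 1" for i
    proof -
      have "(\<Sum>j\<in>UNIV. (c i j)\<^sup>2 / (a i * b j)) = (\<Sum>j\<in>UNIV. (c i j)\<^sup>2 / b j) / a i"
        by (simp add: sum_divide_distrib mult.commute)
      also have "\<dots> \<le> a i / a i"
        using c(1) a(2) by (intro divide_right_mono)
      \<comment> \<open>A vanishing \<open>a i\<close> is covered, since then
        \<open>a i / a i = 0\<close>.\<close>
      also have "\<dots> \<le> 1" by simp
      finally show ?thesis
        using r(1)[of i] by (simp add: D_def sum.distrib flip: sum_divide_distrib)
    qed
    show "(\<Sum>i\<in>UNIV. D i j) \<le> 1" for j
    proof -
      have "(\<Sum>i\<in>UNIV. (c i j)\<^sup>2 / (a i * b j)) = (\<Sum>i\<in>UNIV. (c i j)\<^sup>2 / a i) / b j"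
        by (simp add: sum_divide_distrib)
      also have "\<dots> \<le> b j / b j"
        using c(2) b(2) by (intro divide_right_mono)
      also have "\<dots> \<le> 1" by simp
      finally show ?thesis
        using r(2)[of j] by (simp add: D_def sum.distrib flip: sum_divide_distrib)
    qed
  qed (use a b in \<open>auto simp: D_def antimono_def\<close>)
  finally show ?thesis .
qed

section \<open>The lower bound on the transport cost\<close>

lemma integrable_inner_mult_inner:
  fixes f g :: "'b \<Rightarrow> real ^ 'n"
  assumes [measurable]: "f \<in> borel_measurable M" "g \<in> borel_measurable M"
    and "integrable M (\<lambda>z. (norm (f z))\<^sup>2)" "integrable M (\<lambda>z. (norm (g z))\<^sup>2)"
  shows "integrable M (\<lambda>z. (a \<bullet> f z) * (b \<bullet> g z))"
proof (rule Bochner_Integration.integrable_bound)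
  show "integrable M (\<lambda>z. norm a * norm b * ((norm (f z))\<^sup>2 + (norm (g z))\<^sup>2))"
    using assms(3,4) by simp
  have "\<bar>(a \<bullet> x) * (b \<bullet> y)\<bar> \<le> norm a * norm b * ((norm x)\<^sup>2 + (norm y)\<^sup>2)" for x y :: "real ^ 'n"
  proof -
    have "0 \<le> (norm x - norm y)\<^sup>2 + norm x ^ 2 + norm y ^ 2" by simp
    then have "norm x * norm y \<le> (norm x)\<^sup>2 + (norm y)\<^sup>2"
      by (simp add: power2_eq_square algebra_simps)
    have "\<bar>(a \<bullet> x) * (b \<bullet> y)\<bar> \<le> (norm a * norm x) * (norm b * norm y)"
      unfolding abs_mult by (intro mult_mono Cauchy_Schwarz_ineq2) auto
    also have "\<dots> = norm a * norm b * (norm x * norm y)" by simp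
    also have "\<dots> \<le> norm a * norm b * ((norm x)\<^sup>2 + (norm y)\<^sup>2)"
      by (intro mult_left_mono) (use \<open>norm x * norm y \<le> _\<close> in auto)
    finally show ?thesis .
  qed
  then show "AE z in M. norm ((a \<bullet> f z) * (b \<bullet> g z)) \<le> norm (norm a * norm b * ((norm (f z))\<^sup>2 + (norm (g z))\<^sup>2))"
    by (intro AE_I2) (simp add: abs_mult)
qed simp

text \<open>Replaces the covariance matrix by scalar second moments, which transfer directly along
  marginals and image measures.\<close>

lemma covariance_bilinear:
  fixes \<mu> :: "(real ^ 'n) measure"
  assumes "sets \<mu> = sets borel" "integrable \<mu> (\<lambda>x. (norm x)\<^sup>2)"
  shows "v \<bullet> (covariance \<mu> *v w) = (LINT x|\<mu>. (v \<bullet> x) * (w \<bullet> x))"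
proof -
  have [measurable]: "(\<lambda>x. x) \<in> borel_measurable \<mu>"
    using assms(1) by (simp add: measurable_ident_sets)
  have int: "integrable \<mu> (\<lambda>x. x $ i * x $ j)" for i j
    using integrable_inner_mult_inner[of "\<lambda>x. x" \<mu> "\<lambda>x. x" "axis i 1" "axis j 1"] assms(2)
    by (simp add: inner_axis')
  have "(v \<bullet> x) * (w \<bullet> x) = (\<Sum>i\<in>UNIV. \<Sum>j\<in>UNIV. v $ i * w $ j * (x $ i * x $ j))" for x
    by (simp add: inner_vec_def sum_product mult_ac)
  then have "(LINT x|\<mu>. (v \<bullet> x) * (w \<bullet> x)) =
      (\<Sum>i\<in>UNIV. \<Sum>j\<in>UNIV. v $ i * w $ j * (LINT x|\<mu>. x $ i * x $ j))"
    using int by (simp add: Bochner_Integration.integral_sum)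
  then show ?thesis
    by (simp add: inner_vec_def matrix_vector_mult_def covariance_def sum_distrib_left mult_ac)
qed

text \<open>In an eigenbasis of the covariance the coordinates are uncorrelated and have the
  eigenvalues as variances, which is also why these are nonnegative.\<close>

lemma centered_P2_eigenbasis:
  fixes \<mu> :: "(real ^ ('n :: {finite, linorder})) measure"
  assumes "\<mu> \<in> centered_P2"
  obtains u where "orthonormal_family u"
    "\<And>i j. (LINT x|\<mu>. (u i \<bullet> x) * (u j \<bullet> x)) = (if i = j then eigenvalue_vector (covariance \<mu>) $ i else 0)"
    "antimono (($) (eigenvalue_vector (covariance \<mu>)))"
    "\<And>i. 0 \<le> eigenvalue_vector (covariance \<mu>) $ i"
proof -
  have \<mu>: "sets \<mu> = sets borel" "integrable \<mu> (\<lambda>x. (norm x)\<^sup>2)"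
    using assms by (auto simp: centered_P2_def)
  have "transpose (covariance \<mu>) = covariance \<mu>"
    by (simp add: vec_eq_iff transpose_def covariance_def mult.commute)
  then obtain u where u: "orthonormal_family u"
    "\<And>i j. u i \<bullet> (covariance \<mu> *v u j) = (if i = j then eigenvalue_vector (covariance \<mu>) $ i else 0)"
    "\<And>i j. i \<le> j \<Longrightarrow> eigenvalue_vector (covariance \<mu>) $ j \<le> eigenvalue_vector (covariance \<mu>) $ i"
    using symmetric_matrix_eigenbasis by blast
  note diag = u(2)[unfolded covariance_bilinear[OF \<mu>]]
  have "0 \<le> eigenvalue_vector (covariance \<mu>) $ i" for i
  proof -
    have "0 \<le> (LINT x|\<mu>. (u i \<bullet> x) * (u i \<bullet> x))"
      by (intro integral_nonneg_AE AE_I2) simp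
    then show ?thesis by (simp add: diag)
  qed
  with u diag that show thesis
    by (simp add: antimono_def)
qed

text \<open>When \<open>b j = 0\<close>, the \<open>j\<close>-th summand is 0 because \<open>x / 0 = 0\<close>.\<close>

lemma bessel_integral:
  fixes \<phi> :: "'a \<Rightarrow> real" and \<psi> :: "'n::finite \<Rightarrow> 'a \<Rightarrow> real"
  assumes "integrable M (\<lambda>z. \<phi> z * \<phi> z)" and c: "\<And>j. integrable M (\<lambda>z. \<phi> z * \<psi> j z)"
    and \<psi>: "\<And>j k. integrable M (\<lambda>z. \<psi> j z * \<psi> k z)"
    and b: "\<And>j k. (LINT z|M. \<psi> j z * \<psi> k z) = (if j = k then b j else 0)"
  shows "(\<Sum>j\<in>UNIV. (LINT z|M. \<phi> z * \<psi> j z)\<^sup>2 / b j) \<le> (LINT z|M. \<phi> z * \<phi> z)"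
proof -
  \<comment> \<open>The \<open>r j\<close> are the coefficients of the projection of
    \<open>\<phi>\<close> onto the orthogonal \<open>\<psi> j\<close>. The inequality says that the
    squared residual has nonnegative integral.\<close>
  define r where "r j = (LINT z|M. \<phi> z * \<psi> j z) / b j" for j
  have "0 \<le> (LINT z|M. (\<phi> z - (\<Sum>j\<in>UNIV. r j * \<psi> j z))\<^sup>2)"
    by (intro integral_nonneg_AE AE_I2) simp
  also have "(\<lambda>z. (\<phi> z - (\<Sum>j\<in>UNIV. r j * \<psi> j z))\<^sup>2) =
      (\<lambda>z. \<phi> z * \<phi> z - 2 * (\<Sum>j\<in>UNIV. r j * (\<phi> z * \<psi> j z)) +
        (\<Sum>j\<in>UNIV. \<Sum>k\<in>UNIV. r j * r k * (\<psi> j z * \<psi> k z)))"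
  proof
    fix z
    have "\<phi> z * (\<Sum>j\<in>UNIV. r j * \<psi> j z) = (\<Sum>j\<in>UNIV. r j * (\<phi> z * \<psi> j z))"
      by (simp add: sum_distrib_left mult_ac)
    moreover have "(\<Sum>j\<in>UNIV. r j * \<psi> j z)\<^sup>2 = (\<Sum>j\<in>UNIV. \<Sum>k\<in>UNIV. r j * r k * (\<psi> j z * \<psi> k z))"
      by (simp add: power2_eq_square sum_product mult_ac)
    ultimately show "(\<phi> z - (\<Sum>j\<in>UNIV. r j * \<psi> j z))\<^sup>2 = \<phi> z * \<phi> z -
        2 * (\<Sum>j\<in>UNIV. r j * (\<phi> z * \<psi> j z)) +
        (\<Sum>j\<in>UNIV. \<Sum>k\<in>UNIV. r j * r k * (\<psi> j z * \<psi> k z))"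
      by (simp add: power2_diff) (simp add: power2_eq_square)
  qed
  also have "(LINT z|M. \<dots> z) = (LINT z|M. \<phi> z * \<phi> z) - 2 * (\<Sum>j\<in>UNIV. r j * (LINT z|M. \<phi> z * \<psi> j z)) +
        (\<Sum>j\<in>UNIV. \<Sum>k\<in>UNIV. r j * r k * (LINT z|M. \<psi> j z * \<psi> k z))"
    using assms(1) c \<psi> by (simp add: Bochner_Integration.integral_sum)
  \<comment> \<open>By orthogonality the double sum collapses to the value of the single one, so
    exactly one copy remains, with a negative sign.\<close>
  also have "\<dots> = (LINT z|M. \<phi> z * \<phi> z) - (\<Sum>j\<in>UNIV. (LINT z|M. \<phi> z * \<psi> j z)\<^sup>2 / b j)"
  proof -
    have "(\<Sum>j\<in>UNIV. \<Sum>k\<in>UNIV. r j * r k * (LINT z|M. \<psi> j z * \<psi> k z)) =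
        (\<Sum>j\<in>UNIV. (LINT z|M. \<phi> z * \<psi> j z)\<^sup>2 / b j)"
      by (intro sum.cong refl) (simp add: b r_def power2_eq_square if_distrib[of "\<lambda>y. _ * y"] cong: if_cong)
    moreover have "(\<Sum>j\<in>UNIV. r j * (LINT z|M. \<phi> z * \<psi> j z)) =
        (\<Sum>j\<in>UNIV. (LINT z|M. \<phi> z * \<psi> j z)\<^sup>2 / b j)"
      by (simp add: r_def power2_eq_square)
    ultimately show ?thesis by simp
  qed
  finally show ?thesis by simp
qed

text \<open>A zero second moment forces \<open>\<phi>\<close> to vanish almost everywhere. This
  supplies the degenerate case of \<open>cross_trace_le\<close>, where an eigenvalue is 0.\<close>

lemma integral_mult_eq_0_if_square_integral_eq_0:
  fixes \<phi> \<psi> :: "'a \<Rightarrow> real"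
  assumes "integrable M (\<lambda>z. \<phi> z * \<phi> z)" "(LINT z|M. \<phi> z * \<phi> z) = 0"
  shows "(LINT z|M. \<phi> z * \<psi> z) = 0"
proof (rule integral_eq_zero_AE)
  have "AE z in M. \<phi> z * \<phi> z = 0"
    using assms by (subst (asm) integral_nonneg_eq_0_iff_AE) auto
  then show "AE z in M. \<phi> z * \<psi> z = 0"
    by (auto elim: eventually_mono)
qed

text \<open>The marginals fix the square terms of the cost. Only the cross moments
  \<open>c i j\<close> depend on the coupling, and \<open>cross_trace_le\<close> bounds their
  contribution.\<close>

lemma hellinger_le_coupling_cost:
  fixes \<mu> \<nu> :: "(real ^ ('n :: {finite, linorder})) measure"
  assumes \<mu>: "\<mu> \<in> centered_P2" and \<nu>: "\<nu> \<in> centered_P2" and \<pi>: "\<pi> \<in> couplings \<mu> \<nu>"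
  shows "(hellinger (eigenvalue_vector (covariance \<mu>)) (eigenvalue_vector (covariance \<nu>)))\<^sup>2 \<le>
    (LINT z|\<pi>. (norm (fst z - snd z))\<^sup>2)"
proof -
  define a where "a = ($) (eigenvalue_vector (covariance \<mu>))"
  define b where "b = ($) (eigenvalue_vector (covariance \<nu>))"
  obtain u where u: "orthonormal_family u"
    "\<And>i j. (LINT x|\<mu>. (u i \<bullet> x) * (u j \<bullet> x)) = (if i = j then a i else 0)"
    "antimono a" "\<And>i. 0 \<le> a i"
    using centered_P2_eigenbasis[OF \<mu>] unfolding a_def by metis
  obtain v where v: "orthonormal_family v"
    "\<And>i j. (LINT x|\<nu>. (v i \<bullet> x) * (v j \<bullet> x)) = (if i = j then b i else 0)"
    "antimono b" "\<And>i. 0 \<le> b i"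
    using centered_P2_eigenbasis[OF \<nu>] unfolding b_def by metis
  have sets [measurable_cong]: "sets \<pi> = sets borel"
    and marg: "distr \<pi> borel fst = \<mu>" "distr \<pi> borel snd = \<nu>"
    using \<pi> by (auto simp: couplings_def)
  have [measurable]: "fst \<in> borel_measurable \<pi>" "snd \<in> borel_measurable \<pi>"
    using sets by (auto simp: borel_prod[symmetric] cong: measurable_cong_sets)
  have fst2: "integrable \<pi> (\<lambda>z. (norm (fst z))\<^sup>2)"
    using \<mu> integrable_distr[of fst \<pi> borel "\<lambda>x. (norm x)\<^sup>2"] by (simp add: centered_P2_def marg)
  have snd2: "integrable \<pi> (\<lambda>z. (norm (snd z))\<^sup>2)"
    using \<nu> integrable_distr[of snd \<pi> borel "\<lambda>x. (norm x)\<^sup>2"] by (simp add: centered_P2_def marg)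
  let ?\<phi> = "\<lambda>i z. u i \<bullet> fst z" and ?\<psi> = "\<lambda>j z. v j \<bullet> snd z"
  have int: "integrable \<pi> (\<lambda>z. ?\<phi> i z * ?\<phi> j z)" "integrable \<pi> (\<lambda>z. ?\<psi> i z * ?\<psi> j z)"
    "integrable \<pi> (\<lambda>z. ?\<phi> i z * ?\<psi> j z)" "integrable \<pi> (\<lambda>z. ?\<psi> i z * ?\<phi> j z)" for i j
    using fst2 snd2 by (auto intro!: integrable_inner_mult_inner)
  have \<phi>: "(LINT z|\<pi>. ?\<phi> i z * ?\<phi> j z) = (if i = j then a i else 0)" for i j
    unfolding u(2)[symmetric] marg(1)[symmetric] by (subst integral_distr) auto
  have \<psi>: "(LINT z|\<pi>. ?\<psi> i z * ?\<psi> j z) = (if i = j then b i else 0)" for i j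
    unfolding v(2)[symmetric] marg(2)[symmetric] by (subst integral_distr) auto
  define c where "c i j = (LINT z|\<pi>. ?\<phi> i z * ?\<psi> j z)" for i j
  \<comment> \<open>Read this way, Bessel's inequality applies with the marginals exchanged and
    yields the column sums.\<close>
  have c': "c i j = (LINT z|\<pi>. ?\<psi> j z * ?\<phi> i z)" for i j
    by (simp add: c_def mult.commute)
  have trace: "(\<Sum>i\<in>UNIV. \<Sum>j\<in>UNIV. c i j * (u i \<bullet> v j)) \<le> (\<Sum>i\<in>UNIV. sqrt (a i) * sqrt (b i))"
  proof (rule cross_trace_le)
    show "(\<Sum>j\<in>UNIV. (c i j)\<^sup>2 / b j) \<le> a i" for i
      using bessel_integral[of \<pi> "?\<phi> i" ?\<psi> b] int \<psi> \<phi>[of i i] by (simp add: c_def)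
    show "(\<Sum>i\<in>UNIV. (c i j)\<^sup>2 / a i) \<le> b j" for j
      using bessel_integral[of \<pi> "?\<psi> j" ?\<phi> a] int \<phi> \<psi>[of j j] by (simp add: c')
    show "c i j = 0" if "a i = 0 \<or> b j = 0" for i j
      using that
    proof
      assume "a i = 0"
      then show ?thesis
        unfolding c_def using integral_mult_eq_0_if_square_integral_eq_0[OF int(1)[of i i]] \<phi>[of i i] by simp
    next
      assume "b j = 0"
      then show ?thesis
        unfolding c' using integral_mult_eq_0_if_square_integral_eq_0[OF int(2)[of j j]] \<psi>[of j j] by simp
    qed
    \<comment> \<open>Parseval in the basis \<open>v\<close> turns the row sum into the squared norm
      of \<open>u i\<close>; columns are handled symmetrically.\<close>
    show "(\<Sum>j\<in>UNIV. (u i \<bullet> v j)\<^sup>2) \<le> 1" for i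
      using orthonormal_family_parseval[OF v(1), of "u i" "u i"] orthonormal_family_inner[OF u(1), of i i]
      by (simp add: power2_eq_square inner_commute)
    show "(\<Sum>i\<in>UNIV. (u i \<bullet> v j)\<^sup>2) \<le> 1" for j
      using orthonormal_family_parseval[OF u(1), of "v j" "v j"] orthonormal_family_inner[OF v(1), of j j]
      by (simp add: power2_eq_square)
  qed (use u v in auto)
  \<comment> \<open>Each square is expanded in the eigenbasis of its own marginal, so only the mixed
    term involves both bases.\<close>
  have "(norm (x - y))\<^sup>2 = (\<Sum>i\<in>UNIV. (u i \<bullet> x) * (u i \<bullet> x)) + (\<Sum>i\<in>UNIV. (v i \<bullet> y) * (v i \<bullet> y)) -
      2 * (\<Sum>i\<in>UNIV. \<Sum>j\<in>UNIV. (u i \<bullet> x) * (v j \<bullet> y) * (u i \<bullet> v j))" for x y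
  proof -
    have "(norm (x - y))\<^sup>2 = x \<bullet> x + y \<bullet> y - 2 * (x \<bullet> y)"
      by (simp add: power2_norm_eq_inner inner_simps inner_commute)
    moreover have "x \<bullet> y = (\<Sum>i\<in>UNIV. \<Sum>j\<in>UNIV. (u i \<bullet> x) * (v j \<bullet> y) * (u i \<bullet> v j))"
      unfolding orthonormal_family_parseval[OF u(1), of x y]
      by (subst orthonormal_family_parseval[OF v(1)]) (simp add: sum_distrib_left inner_commute mult_ac)
    ultimately show ?thesis
      using orthonormal_family_parseval[OF u(1), of x x] orthonormal_family_parseval[OF v(1), of y y]
      by simp
  qed
  then have "(LINT z|\<pi>. (norm (fst z - snd z))\<^sup>2) = (\<Sum>i\<in>UNIV. a i) + (\<Sum>i\<in>UNIV. b i) -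
      2 * (\<Sum>i\<in>UNIV. \<Sum>j\<in>UNIV. c i j * (u i \<bullet> v j))"
    using int by (simp add: \<phi> \<psi> c_def Bochner_Integration.integral_sum)
  moreover have "(hellinger (eigenvalue_vector (covariance \<mu>)) (eigenvalue_vector (covariance \<nu>)))\<^sup>2 =
      (\<Sum>i\<in>UNIV. (sqrt (a i) - sqrt (b i))\<^sup>2)"
    unfolding hellinger_def power2_norm_eq_inner
    by (simp add: inner_vec_def power2_eq_square a_def b_def)
  moreover have "\<dots> = (\<Sum>i\<in>UNIV. a i) + (\<Sum>i\<in>UNIV. b i) - 2 * (\<Sum>i\<in>UNIV. sqrt (a i) * sqrt (b i))"
    using u(4) v(4) by (simp add: power2_diff sum.distrib sum_subtractf sum_distrib_left mult.assoc)
  ultimately show ?thesis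
    using trace by linarith
qed

section \<open>An optimal coupling\<close>

lemma (in pair_sigma_finite) integral_mult_pair:
  fixes f :: "'a \<Rightarrow> real" and g :: "'b \<Rightarrow> real"
  assumes f: "integrable M1 f" and g: "integrable M2 g"
  shows "integrable (M1 \<Otimes>\<^sub>M M2) (\<lambda>w. f (fst w) * g (snd w))"
    and "(LINT w|(M1 \<Otimes>\<^sub>M M2). f (fst w) * g (snd w)) = (LINT x|M1. f x) * (LINT y|M2. g y)"
proof -
  have [measurable]: "f \<in> borel_measurable M1" "g \<in> borel_measurable M2"
    using f g by auto
  show int: "integrable (M1 \<Otimes>\<^sub>M M2) (\<lambda>w. f (fst w) * g (snd w))"
    using f g by (intro Fubini_integrable) (auto simp: abs_mult)
  show "(LINT w|(M1 \<Otimes>\<^sub>M M2). f (fst w) * g (snd w)) = (LINT x|M1. f x) * (LINT y|M2. g y)"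
    unfolding integral_fst'[OF int, symmetric] by simp
qed

lemma (in finite_measure) integrable_if_square_norm_integrable:
  fixes f :: "'a \<Rightarrow> 'b :: {banach, second_countable_topology}"
  assumes "f \<in> borel_measurable M" "integrable M (\<lambda>x. (norm (f x))\<^sup>2)"
  shows "integrable M f"
  using square_integrable_imp_integrable[of "\<lambda>x. norm (f x)"] assms
  by (simp add: integrable_norm_iff)

text \<open>
  A signed coordinate vector, uniformly chosen and scaled to have identity covariance: a finitely
  supported source of noise.
\<close>

definition axis_noise :: "'n \<Rightarrow> 'n::finite \<times> bool \<Rightarrow> real" where
  "axis_noise i k = (if fst k = i then (if snd k then 1 else - 1) * sqrt (real CARD('n)) else 0)"

lemma integral_uniform_pmf:
  fixes g :: "'n::finite \<times> bool \<Rightarrow> real"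
  shows "(LINT k|(measure_pmf (pmf_of_set UNIV)). g k) =
    (\<Sum>i\<in>UNIV. g (i, True) + g (i, False)) / (2 * real CARD('n))"
proof -
  have "(\<Sum>k\<in>UNIV. g k) = (\<Sum>i\<in>UNIV. \<Sum>b\<in>UNIV. g (i, b))"
    by (simp add: sum.cartesian_product)
  also have "\<dots> = (\<Sum>i\<in>UNIV. g (i, True) + g (i, False))"
    by (simp add: UNIV_bool add.commute)
  finally show ?thesis
    by (simp add: integral_pmf_of_set mult.commute)
qed

text \<open>Opposite signs cancel in the mean, different coordinates are never nonzero together, and
  the scaling compensates for the probability of choosing a given axis.\<close>

lemma axis_noise_moments:
  "(LINT k|(measure_pmf (pmf_of_set UNIV)). axis_noise i k) = 0"
  "(LINT k|(measure_pmf (pmf_of_set UNIV)). axis_noise i k * axis_noise j k) = (if i = j then 1 else 0)"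
proof -
  show "(LINT k|(measure_pmf (pmf_of_set UNIV)). axis_noise i k) = 0"
  proof -
    have "axis_noise i (l, True) + axis_noise i (l, False) = 0" for l :: 'a
      by (simp add: axis_noise_def)
    then show ?thesis
      unfolding integral_uniform_pmf by simp
  qed
  have "axis_noise i (l, b) * axis_noise j (l, b) = (if l = i then if i = j then real CARD('a) else 0 else 0)"
    for l :: 'a and b
    by (simp add: axis_noise_def)
  then show "(LINT k|(measure_pmf (pmf_of_set UNIV)). axis_noise i k * axis_noise j k) = (if i = j then 1 else 0)"
    unfolding integral_uniform_pmf by (simp add: if_distrib[of "\<lambda>y. 2 * y"] cong: if_cong)
qed

text \<open>Rescaling along the principal axes reaches every prescribed variance except on an axis
  of variance 0. There only additional randomness helps, hence the product with a noise
  space.\<close>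

lemma optimal_coupling_exists:
  fixes \<mu> :: "(real ^ ('n :: {finite, linorder})) measure" and x :: "real ^ ('n :: {finite, linorder})"
  assumes \<mu>: "\<mu> \<in> centered_P2" and x: "x \<in> nonneg_vectors"
  obtains \<nu> \<pi> p where "\<nu> \<in> centered_P2" "\<pi> \<in> couplings \<mu> \<nu>"
    "p permutes UNIV" "eigenvalue_vector (covariance \<nu>) = (\<chi> i. x $ p i)"
    "(LINT z|\<pi>. (norm (fst z - snd z))\<^sup>2) = (hellinger (eigenvalue_vector (covariance \<mu>)) x)\<^sup>2"
proof -
  define a where "a = ($) (eigenvalue_vector (covariance \<mu>))"
  obtain u where u: "orthonormal_family u"
    "\<And>i j. (LINT x|\<mu>. (u i \<bullet> x) * (u j \<bullet> x)) = (if i = j then a i else 0)" "\<And>i. 0 \<le> a i"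
    using centered_P2_eigenbasis[OF \<mu>] unfolding a_def by metis
  have x0: "0 \<le> x $ i" for i
    using x by (simp add: nonneg_vectors_def)
  have sets [measurable_cong]: "sets \<mu> = sets borel" and "prob_space \<mu>"
    and sq: "integrable \<mu> (\<lambda>x. (norm x)\<^sup>2)" and mean: "(LINT x|\<mu>. x) = 0"
    using \<mu> by (auto simp: centered_P2_def)
  define K where "K = measure_pmf (pmf_of_set (UNIV :: ('n \<times> bool) set))"
  define N where "N = \<mu> \<Otimes>\<^sub>M K"
  interpret P: pair_prob_space \<mu> K
    using \<open>prob_space \<mu>\<close> unfolding pair_prob_space_def pair_sigma_finite_def K_def
    by (auto intro: prob_space_imp_sigma_finite prob_space_measure_pmf)
  have int_K: "integrable K g" for g :: "_ \<Rightarrow> real"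
    unfolding K_def by (intro integrable_measure_pmf_finite) simp
  have [measurable]: "g \<in> borel_measurable K" for g :: "_ \<Rightarrow> real"
    by (simp add: K_def)
  have meas_id: "(\<lambda>x. x) \<in> borel_measurable \<mu>"
    using sets by (simp add: measurable_ident_sets)
  have int_id: "integrable \<mu> (\<lambda>x. x)"
    using meas_id sq by (rule P.M1.integrable_if_square_norm_integrable)
  have int_u: "integrable \<mu> (\<lambda>x. u i \<bullet> x)" and mean_u: "(LINT x|\<mu>. u i \<bullet> x) = 0" for i
    using int_id mean by auto
  have int_uu: "integrable \<mu> (\<lambda>x. (u i \<bullet> x) * (u j \<bullet> x))" for i j
    using meas_id meas_id sq sq by (rule integrable_inner_mult_inner)
  \<comment> \<open>The coordinates of the new vector, and of its difference from the given one, all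
    have this form, so one moment formula serves both the covariance and the cost.\<close>
  define h where "h p q i w = p * (u i \<bullet> fst w) + q * axis_noise i (snd w)"
    for p q i w
  have [measurable]: "h p q i \<in> borel_measurable N" for p q i
    unfolding h_def N_def by measurable
  have h1: "integrable N (h p q i)" "(LINT w|N. h p q i w) = 0" for p q i
  proof -
    have *: "integrable N (\<lambda>w. u i \<bullet> fst w)" "(LINT w|N. u i \<bullet> fst w) = 0"
      using P.integral_mult_pair[OF int_u[of i] int_K[of "\<lambda>_. 1"]] mean_u[of i] by (auto simp: N_def)
    have "integrable N (\<lambda>w. axis_noise i (snd w))" "(LINT w|N. axis_noise i (snd w)) = 0"
      using P.integral_mult_pair[OF P.M1.integrable_const[of 1] int_K[of "axis_noise i"]]
        axis_noise_moments(1)[of i, folded K_def] by (auto simp: N_def)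
    with * show "integrable N (h p q i)" "(LINT w|N. h p q i w) = 0"
      unfolding h_def by auto
  qed
  have h2: "integrable N (\<lambda>w. h p q i w * h p' q' j w)"
    "(LINT w|N. h p q i w * h p' q' j w) = (if i = j then p * p' * a i + q * q' else 0)"
    for p q p' q' i j
  proof -
    note m1 = P.integral_mult_pair[OF int_uu[of i j] int_K[of "\<lambda>_. 1"], folded N_def]
    note m2 = P.integral_mult_pair[OF int_u[of i] int_K[of "axis_noise j"], folded N_def]
    note m3 = P.integral_mult_pair[OF int_u[of j] int_K[of "axis_noise i"], folded N_def]
    note m4 = P.integral_mult_pair[OF P.M1.integrable_const[of 1]
        int_K[of "\<lambda>k. axis_noise i k * axis_noise j k"], folded N_def]
    \<comment> \<open>Of the four products the two mixed ones integrate to 0, their factors being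
      independent and centered.\<close>
    have eq: "(\<lambda>w. h p q i w * h p' q' j w) = (\<lambda>w. p * p' * ((u i \<bullet> fst w) * (u j \<bullet> fst w) * 1) +
        p * q' * ((u i \<bullet> fst w) * axis_noise j (snd w)) + q * p' * ((u j \<bullet> fst w) * axis_noise i (snd w)) +
        q * q' * (1 * (axis_noise i (snd w) * axis_noise j (snd w))))"
      by (intro ext) (simp add: h_def algebra_simps)
    show "integrable N (\<lambda>w. h p q i w * h p' q' j w)"
      unfolding eq
      by (intro Bochner_Integration.integrable_add integrable_mult_right m1(1) m2(1) m3(1) m4(1))
    have "(LINT w|N. h p q i w * h p' q' j w) = p * p' * ((LINT x|\<mu>. (u i \<bullet> x) * (u j \<bullet> x)) * (LINT k|K. 1)) +
        p * q' * ((LINT x|\<mu>. u i \<bullet> x) * (LINT k|K. axis_noise j k)) +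
        q * p' * ((LINT x|\<mu>. u j \<bullet> x) * (LINT k|K. axis_noise i k)) +
        q * q' * ((LINT x|\<mu>. 1) * (LINT k|K. axis_noise i k * axis_noise j k))"
      unfolding eq m1(2)[symmetric] m2(2)[symmetric] m3(2)[symmetric] m4(2)[symmetric]
      using m1(1) m2(1) m3(1) m4(1)
      by (simp only: Bochner_Integration.integral_add Bochner_Integration.integrable_add
          integrable_mult_right integral_mult_right_zero)
    then show "(LINT w|N. h p q i w * h p' q' j w) = (if i = j then p * p' * a i + q * q' else 0)"
      using axis_noise_moments[where 'a='n, folded K_def] P.M1.prob_space P.M2.prob_space
      by (simp add: u(2) mean_u)
  qed
  \<comment> \<open>Chosen so that
    \<open>(\<alpha> i)\<^sup>2 * a i + (\<beta> i)\<^sup>2 = x $ i\<close> for every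
    \<open>i\<close>.\<close>
  define \<alpha> where "\<alpha> i = sqrt (x $ i / a i)" for i
  define \<beta> where "\<beta> i = (if a i = 0 then sqrt (x $ i) else 0)" for i
  \<comment> \<open>\<open>\<alpha> i = 0\<close> when \<open>a i = 0\<close>, because \<open>x / 0 = 0\<close>.\<close>
  define T where "T w = (\<Sum>i\<in>UNIV. h (\<alpha> i) (\<beta> i) i w *\<^sub>R u i)" for w
  have [measurable]: "T \<in> borel_measurable N"
    unfolding T_def by measurable
  have uT: "u i \<bullet> T w = h (\<alpha> i) (\<beta> i) i w" for i w
    by (simp add: T_def inner_sum_right orthonormal_family_inner[OF u(1)] if_distrib cong: if_cong)
  have norm_sq: "(norm y)\<^sup>2 = (\<Sum>i\<in>UNIV. (u i \<bullet> y) * (u i \<bullet> y))" for y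
    using orthonormal_family_parseval[OF u(1), of y y] by (simp add: power2_norm_eq_inner)
  have [measurable]: "fst \<in> borel_measurable N"
    unfolding N_def by measurable
  have probN: "prob_space N"
    unfolding N_def by (rule P.prob_space_axioms)
  define \<nu> where "\<nu> = distr N borel T"
  define \<pi> where "\<pi> = distr N (borel \<Otimes>\<^sub>M borel) (\<lambda>w. (fst w, T w))"
  have int_T: "integrable N (\<lambda>w. (norm (T w))\<^sup>2)"
    unfolding norm_sq uT using h2(1) by (intro Bochner_Integration.integrable_sum)
  have "(LINT w|N. T w) = 0"
    unfolding T_def using h1 by (simp add: Bochner_Integration.integral_sum)
  then have \<nu>: "\<nu> \<in> centered_P2"
    using probN int_T
    by (simp add: centered_P2_def \<nu>_def prob_space.prob_space_distr integrable_distr_eq integral_distr)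
  have "\<pi> \<in> couplings \<mu> \<nu>"
  proof -
    have "distr \<pi> borel fst = distr N borel fst" "distr \<pi> borel snd = \<nu>"
      unfolding \<pi>_def \<nu>_def by (subst distr_distr; simp add: o_def)+
    moreover have "distr N borel fst = \<mu>"
      using P.M2.distr_pair_fst[of \<mu>] distr_cong[OF refl sets[symmetric], of N fst fst] by (simp add: N_def)
    moreover have "prob_space \<pi>"
      unfolding \<pi>_def by (intro prob_space.prob_space_distr[OF probN]) measurable
    ultimately show ?thesis
      by (simp add: couplings_def \<pi>_def borel_prod)
  qed
  have "u i \<bullet> (covariance \<nu> *v u j) = (if i = j then x $ i else 0)" for i j
  proof -
    have "u i \<bullet> (covariance \<nu> *v u j) = (LINT y|\<nu>. (u i \<bullet> y) * (u j \<bullet> y))"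
      using \<nu> by (intro covariance_bilinear) (auto simp: centered_P2_def)
    also have "\<dots> = (LINT w|N. h (\<alpha> i) (\<beta> i) i w * h (\<alpha> j) (\<beta> j) j w)"
      unfolding \<nu>_def by (subst integral_distr) (auto simp: uT)
    also have "\<dots> = (if i = j then x $ i else 0)"
      using x0 u(3) by (auto simp: h2 \<alpha>_def \<beta>_def)
    finally show ?thesis .
  qed
  with u(1) obtain p where "p permutes UNIV" "eigenvalue_vector (covariance \<nu>) = (\<chi> i. x $ p i)"
    by (rule eigenvalue_vector_permuted)
  moreover have "(LINT z|\<pi>. (norm (fst z - snd z))\<^sup>2) = (hellinger (eigenvalue_vector (covariance \<mu>)) x)\<^sup>2"
  proof -
    have "(LINT z|\<pi>. (norm (fst z - snd z))\<^sup>2) = (LINT w|N. (norm (fst w - T w))\<^sup>2)"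
      unfolding \<pi>_def by (subst integral_distr) auto
    also have "\<dots> = (LINT w|N. (\<Sum>i\<in>UNIV. h (1 - \<alpha> i) (- \<beta> i) i w * h (1 - \<alpha> i) (- \<beta> i) i w))"
      unfolding norm_sq inner_diff_right uT by (simp add: h_def algebra_simps)
    also have "\<dots> = (\<Sum>i\<in>UNIV. (1 - \<alpha> i) * (1 - \<alpha> i) * a i + \<beta> i * \<beta> i)"
      using h2(1) by (simp add: Bochner_Integration.integral_sum h2(2))
    also have "\<dots> = (\<Sum>i\<in>UNIV. (sqrt (a i) - sqrt (x $ i))\<^sup>2)"
    proof (intro sum.cong refl)
      fix i
      \<comment> \<open>With \<open>s\<close> and \<open>y\<close> the square roots of
        \<open>a i\<close> and \<open>x $ i\<close>, this is a plain identity. If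
        \<open>a i = 0\<close>, the noise term alone contributes the required
        \<open>x $ i\<close>.\<close>
      have "(1 - \<alpha> i) * (1 - \<alpha> i) * a i = (sqrt (a i) - sqrt (x $ i))\<^sup>2" if "a i \<noteq> 0"
      proof -
        have "(1 - y / s) * (1 - y / s) * s\<^sup>2 = (s - y)\<^sup>2" if "s \<noteq> 0" for y s :: real
          using that by (simp add: field_simps power2_eq_square)
        from this[of "sqrt (a i)" "sqrt (x $ i)"] show ?thesis
          using that u(3)[of i] by (simp add: \<alpha>_def real_sqrt_divide)
      qed
      then show "(1 - \<alpha> i) * (1 - \<alpha> i) * a i + \<beta> i * \<beta> i = (sqrt (a i) - sqrt (x $ i))\<^sup>2"
        using x0[of i] by (auto simp: \<beta>_def)
    qed
    also have "\<dots> = (hellinger (eigenvalue_vector (covariance \<mu>)) x)\<^sup>2"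
      unfolding hellinger_def power2_norm_eq_inner by (simp add: inner_vec_def power2_eq_square a_def)
    finally show ?thesis .
  qed
  ultimately show thesis
    using that \<nu> \<open>\<pi> \<in> couplings \<mu> \<nu>\<close> by blast
qed

section \<open>From couplings to distances and envelopes\<close>

lemma couplings_nonempty:
  assumes "prob_space \<mu>" "sets \<mu> = sets borel" "prob_space \<nu>" "sets \<nu> = sets borel"
  shows "couplings \<mu> \<nu> \<noteq> {}"
proof -
  interpret P: pair_prob_space \<mu> \<nu>
    using assms(1,3) by (auto simp: pair_prob_space_def pair_sigma_finite_def prob_space_imp_sigma_finite)
  interpret Q: pair_prob_space \<nu> \<mu>
    using assms(1,3) by (auto simp: pair_prob_space_def pair_sigma_finite_def prob_space_imp_sigma_finite)
  have "distr (\<mu> \<Otimes>\<^sub>M \<nu>) borel fst = \<mu>"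
    using P.M2.distr_pair_fst[of \<mu>] distr_cong[OF refl assms(2)[symmetric], of "\<mu> \<Otimes>\<^sub>M \<nu>" fst fst] by simp
  \<comment> \<open>Swapping the factors reduces the second marginal to the first.\<close>
  moreover have "distr (\<mu> \<Otimes>\<^sub>M \<nu>) borel snd = \<nu>"
  proof -
    have [measurable]: "snd \<in> borel_measurable (\<mu> \<Otimes>\<^sub>M \<nu>)"
      using measurable_snd[of \<mu> \<nu>] assms(4) by (simp cong: measurable_cong_sets)
    have swap: "snd \<circ> (\<lambda>(x, y). (y, x)) = fst"
      by auto
    have "distr (\<mu> \<Otimes>\<^sub>M \<nu>) borel snd =
        distr (distr (\<nu> \<Otimes>\<^sub>M \<mu>) (\<mu> \<Otimes>\<^sub>M \<nu>) (\<lambda>(x, y). (y, x))) borel snd"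
      using P.distr_pair_swap by simp
    also have "\<dots> = distr (\<nu> \<Otimes>\<^sub>M \<mu>) borel fst"
      by (subst distr_distr) (simp_all only: swap measurable_pair_swap'  \<open>snd \<in> borel_measurable _\<close>)
    also have "\<dots> = distr (\<nu> \<Otimes>\<^sub>M \<mu>) \<nu> fst"
      using assms(4) by (intro distr_cong) auto
    finally have "distr (\<mu> \<Otimes>\<^sub>M \<nu>) borel snd = distr (\<nu> \<Otimes>\<^sub>M \<mu>) \<nu> fst" .
    then show ?thesis
      using P.M1.distr_pair_fst[of \<nu>] by simp
  qed
  moreover have "sets (\<mu> \<Otimes>\<^sub>M \<nu>) = sets borel"
    using sets_pair_measure_cong[OF assms(2,4)] by (simp only: borel_prod)
  ultimately have "\<mu> \<Otimes>\<^sub>M \<nu> \<in> couplings \<mu> \<nu>"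
    using P.prob_space_axioms by (simp add: couplings_def)
  then show ?thesis by blast
qed

lemma hellinger_le_wasserstein2:
  fixes \<mu> \<nu> :: "(real ^ ('n :: {finite, linorder})) measure"
  assumes \<mu>: "\<mu> \<in> centered_P2" and \<nu>: "\<nu> \<in> centered_P2"
  shows "(hellinger (eigenvalue_vector (covariance \<mu>)) (eigenvalue_vector (covariance \<nu>)))\<^sup>2 \<le>
    (wasserstein2 \<mu> \<nu>)\<^sup>2"
proof -
  \<comment> \<open>A common lower bound passes to an infimum of reals only over a nonempty
    set.\<close>
  have "couplings \<mu> \<nu> \<noteq> {}"
    using assms by (intro couplings_nonempty) (auto simp: centered_P2_def)
  then have "(hellinger (eigenvalue_vector (covariance \<mu>)) (eigenvalue_vector (covariance \<nu>)))\<^sup>2 \<le>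
      (INF \<pi>\<in>couplings \<mu> \<nu>. LINT z|\<pi>. (norm (fst z - snd z))\<^sup>2)" (is "_ \<le> ?I")
    using hellinger_le_coupling_cost[OF assms] by (intro cINF_greatest)
  \<comment> \<open>Nonnegativity of the infimum lets squaring undo the square root in
    \<open>wasserstein2\<close>.\<close>
  moreover from this have "0 \<le> ?I"
    by (rule order_trans[OF zero_le_power2])
  ultimately show ?thesis
    by (simp add: wasserstein2_def)
qed

lemma wasserstein2_le_coupling_cost:
  assumes "\<pi> \<in> couplings \<mu> \<nu>"
  shows "(wasserstein2 \<mu> \<nu>)\<^sup>2 \<le> (LINT z|\<pi>. (norm (fst z - snd z))\<^sup>2)"
proof -
  have nn: "0 \<le> (LINT z|\<pi>. (norm (fst z - snd z))\<^sup>2)" for \<pi> :: "((real ^ 'n) \<times> (real ^ 'n)) measure"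
    by (intro integral_nonneg_AE AE_I2) simp
  have "(INF \<pi>\<in>couplings \<mu> \<nu>. LINT z|\<pi>. (norm (fst z - snd z))\<^sup>2) \<le> (LINT z|\<pi>. (norm (fst z - snd z))\<^sup>2)"
    using nn assms by (intro cINF_lower bdd_belowI2[where m = 0])
  moreover have "0 \<le> (INF \<pi>\<in>couplings \<mu> \<nu>. LINT z|\<pi>. (norm (fst z - snd z))\<^sup>2)"
    using nn assms by (intro cINF_greatest) auto
  ultimately show ?thesis
    by (simp add: wasserstein2_def)
qed

theorem theoremA7:
  fixes f :: "real ^ ('n :: {finite, linorder}) \<Rightarrow> ereal"
    and F :: "(real ^ ('n :: {finite, linorder})) measure \<Rightarrow> ereal"
    and \<rho> :: real
    and \<mu> :: "(real ^ ('n :: {finite, linorder})) measure"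
  assumes "\<And>x. x \<in> nonneg_vectors \<Longrightarrow> f x \<noteq> -\<infinity>"
    and "symmetric_on_nonneg f"
    and "\<And>\<nu>. \<nu> \<in> centered_P2 \<Longrightarrow> F \<nu> = f (eigenvalue_vector (covariance \<nu>))"
    and "\<rho> > 0"
    and "\<mu> \<in> centered_P2"
  shows "moreau_envelope centered_P2 wasserstein2 \<rho> F \<mu> =
    moreau_envelope nonneg_vectors hellinger \<rho> f (eigenvalue_vector (covariance \<mu>))"
  unfolding moreau_envelope_def
proof (rule antisym)
  show "(INF \<nu>\<in>centered_P2. F \<nu> + ereal (1 / (2 * \<rho>) * (wasserstein2 \<mu> \<nu>)\<^sup>2)) \<le>
    (INF x\<in>nonneg_vectors. f x + ereal (1 / (2 * \<rho>) * (hellinger (eigenvalue_vector (covariance \<mu>)) x)\<^sup>2))"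
  proof (rule INF_mono)
    fix x :: "real ^ ('n :: {finite, linorder})" assume x: "x \<in> nonneg_vectors"
    obtain \<nu> \<pi> p where \<nu>: "\<nu> \<in> centered_P2" and \<pi>: "\<pi> \<in> couplings \<mu> \<nu>" and p: "p permutes UNIV"
      and ev: "eigenvalue_vector (covariance \<nu>) = (\<chi> i. x $ p i)"
      and cost: "(LINT z|\<pi>. (norm (fst z - snd z))\<^sup>2) = (hellinger (eigenvalue_vector (covariance \<mu>)) x)\<^sup>2"
      by (rule optimal_coupling_exists[OF assms(5) x])
    \<comment> \<open>The constructed spectrum is \<open>x\<close> up to order, and the symmetry of
      \<open>f\<close> absorbs the permutation.\<close>
    have "F \<nu> = f x"
      using assms(2) p x by (simp add: assms(3)[OF \<nu>] ev symmetric_on_nonneg_def)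
    moreover have "(wasserstein2 \<mu> \<nu>)\<^sup>2 \<le> (hellinger (eigenvalue_vector (covariance \<mu>)) x)\<^sup>2"
      using wasserstein2_le_coupling_cost[OF \<pi>] by (simp add: cost)
    ultimately show "\<exists>\<nu>\<in>centered_P2. F \<nu> + ereal (1 / (2 * \<rho>) * (wasserstein2 \<mu> \<nu>)\<^sup>2) \<le>
        f x + ereal (1 / (2 * \<rho>) * (hellinger (eigenvalue_vector (covariance \<mu>)) x)\<^sup>2)"
      using \<nu> assms(4) by (intro bexI[of _ \<nu>] add_mono) (auto intro!: divide_right_mono)
  qed
  show "(INF x\<in>nonneg_vectors. f x + ereal (1 / (2 * \<rho>) * (hellinger (eigenvalue_vector (covariance \<mu>)) x)\<^sup>2)) \<le>
    (INF \<nu>\<in>centered_P2. F \<nu> + ereal (1 / (2 * \<rho>) * (wasserstein2 \<mu> \<nu>)\<^sup>2))"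
  proof (rule INF_mono)
    fix \<nu> :: "(real ^ ('n :: {finite, linorder})) measure" assume \<nu>: "\<nu> \<in> centered_P2"
    \<comment> \<open>Each \<open>\<nu>\<close> is matched by its own spectrum, an admissible point
      at which \<open>f\<close> takes the value \<open>F \<nu>\<close>.\<close>
    have "eigenvalue_vector (covariance \<nu>) \<in> nonneg_vectors"
      using centered_P2_eigenbasis[OF \<nu>] unfolding nonneg_vectors_def by blast
    then show "\<exists>x\<in>nonneg_vectors. f x + ereal (1 / (2 * \<rho>) * (hellinger (eigenvalue_vector (covariance \<mu>)) x)\<^sup>2) \<le>
        F \<nu> + ereal (1 / (2 * \<rho>) * (wasserstein2 \<mu> \<nu>)\<^sup>2)"
      using hellinger_le_wasserstein2[OF assms(5) \<nu>] assms(4)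
      by (intro bexI[of _ "eigenvalue_vector (covariance \<nu>)"] add_mono)
        (auto simp: assms(3)[OF \<nu>] intro!: divide_right_mono)
  qed
qed

end
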